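(* For integers $k\ge 2$ and $n\ge 0$, the number of $123$-avoiding $k$-ary shrub forests with $n$ shrubs is $$\left|\mathcal{F}^k_n(123)\right|=\frac{1}{kn+1}\binom{(k+1)n}{n}.$$
   Context: A $k$-ary shrub is a rooted tree whose root has exactly $k$ children, all leaves. A $k$-ary shrub forest of $n$ shrubs is an ordered sequence of $n$ such shrubs (the leaves of each shrub also ordered left to right) whose $(k+1)n$ vertices are labeled bijectively by $\{1,\dots,(k+1)n\}$ so that each leaf has a larger label than its root. Its permutation $\pi_F$ is obtained by reading, shrub by shrub from left to right, the root label followed by the leaf labels from left to right. Equivalently, forests correspond bijectively to permutations $\pi$ of $\{1,\dots,(k+1)n\}$ with $\pi_{(k+1)i+1}<\pi_{(k+1)i+j}$ for all $0\le i<n$, $2\le j\le k+1$. $\mathcal{F}^k_n(P)$ is the set of $k$-ary shrub forests of $n$ shrubs whose permutation $\pi_F$ avoids (in the classical pattern sense) every pattern in $P$. *)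

theory Defs
  imports Complex_Main "HOL-Library.Sublist"
begin

(* A labeled shrub: the label of the root and the labels of its leaf children, left to right. *)
datatype shrub = Shrub (root: nat) (leaves: "nat list")

definition shrub_word :: "shrub \<Rightarrow> nat list" where
  "shrub_word s = root s # leaves s"

(* The permutation of the forest, in one-line notation. *)
definition forest_perm :: "shrub list \<Rightarrow> nat list" where
  "forest_perm F = concat (map shrub_word F)"

(* The last two conjuncts say that the labels 1, ..., (k+1)n are used exactly once each. *)
definition shrub_forest :: "nat \<Rightarrow> nat \<Rightarrow> shrub list \<Rightarrow> bool" where
  "shrub_forest k n F \<longleftrightarrow>
     length F = n \<and>
     (\<forall>s \<in> set F. length (leaves s) = k \<and> (\<forall>l \<in> set (leaves s). root s < l)) \<and>
     distinct (forest_perm F) \<and>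
     set (forest_perm F) = {1..(k + 1) * n}"

definition order_isomorphic :: "nat list \<Rightarrow> nat list \<Rightarrow> bool" where
  "order_isomorphic xs ys \<longleftrightarrow>
     length xs = length ys \<and>
     (\<forall>i < length xs. \<forall>j < length xs. xs ! i < xs ! j \<longleftrightarrow> ys ! i < ys ! j)"

(* Classical containment: subseq is the library's scattered (not necessarily contiguous)
   subsequence relation. *)
definition contains_pattern :: "nat list \<Rightarrow> nat list \<Rightarrow> bool" where
  "contains_pattern w p \<longleftrightarrow> (\<exists>u. subseq u w \<and> order_isomorphic u p)"

definition avoiding_forests :: "nat \<Rightarrow> nat \<Rightarrow> nat list set \<Rightarrow> shrub list set" where
  "avoiding_forests k n P =
     {F. shrub_forest k n F \<and> (\<forall>p \<in> P. \<not> contains_pattern (forest_perm F) p)}"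

end

theory Submission
  imports Defs
begin

text \<open>
  A leaf is preceded by its smaller root, so two leaves in increasing order, or two roots in
  increasing order (the second followed by one of its leaves), would complete a 123. Hence
  the roots decrease along a 123-avoiding forest, and so do the leaves, and the forest is
  determined by its set of root labels. Reading the labels from the largest to the smallest,
  the sets that occur are those for which every initial segment contains at least k times as
  many leaves as roots. These ballot sequences are counted by a Pascal-like recurrence.
\<close>

section \<open>Ballot sets and their enumeration\<close>

text \<open>Only the labels above \<open>d\<close> have been read so far, so that lowering
  \<open>d\<close> by one reads one more label. Of the \<open>N - v\<close> labels above
  \<open>v\<close>, at most one in \<open>k + 1\<close> is a root; this is the condition that leaves
  number at least \<open>k\<close> times the roots, stated without counting leaves.\<close>

definition ballot_sets :: "nat \<Rightarrow> nat \<Rightarrow> nat \<Rightarrow> nat \<Rightarrow> nat set set" where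
  "ballot_sets k N d b =
     {R. R \<subseteq> {d<..N} \<and> card R = b \<and>
         (\<forall>v. d \<le> v \<and> v \<le> N \<longrightarrow> (k + 1) * card (R \<inter> {v<..}) \<le> N - v)}"

lemma finite_ballot_sets: "finite (ballot_sets k N d b)"
  by (rule finite_subset[of _ "Pow {d<..N}"]) (auto simp: ballot_sets_def)

lemma ballot_sets_empty:
  assumes "d \<le> N" "N - d < (k + 1) * b"
  shows "ballot_sets k N d b = {}"
proof -
  have False if "R \<in> ballot_sets k N d b" for R
  proof -
    have "R \<inter> {d<..} = R" "card R = b" "(k + 1) * card (R \<inter> {d<..}) \<le> N - d"
      using that assms(1) by (auto simp: ballot_sets_def)
    then show False using assms(2) by simp
  qed
  then show ?thesis by blast
qed

lemma ballot_sets_0: "ballot_sets k N d 0 = {{}}"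
proof -
  have "R = {}" if "R \<in> ballot_sets k N d 0" for R
  proof -
    have "R \<subseteq> {d<..N}" "card R = 0" using that by (simp_all add: ballot_sets_def)
    then show ?thesis using finite_subset[of R "{d<..N}"] by simp
  qed
  moreover have "{} \<in> ballot_sets k N d 0" by (simp add: ballot_sets_def)
  ultimately show ?thesis by blast
qed

text \<open>The two parts separate by whether the label read last, \<open>Suc d\<close>, is a leaf
  or a root. The conditions at \<open>v \<ge> Suc d\<close> do not see this label, and the one new
  condition, at \<open>v = d\<close>, is the second assumption.\<close>

lemma ballot_sets_Suc:
  assumes "d < N" "(k + 1) * Suc b \<le> N - d"
  shows "ballot_sets k N d (Suc b) =
           ballot_sets k N (Suc d) (Suc b) \<union> insert (Suc d) ` ballot_sets k N (Suc d) b"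
    (is "?L = ?A \<union> ?B")
proof (intro equalityI subsetI)
  fix R assume R: "R \<in> ?L"
  then have sub: "R \<subseteq> {d<..N}" and card: "card R = Suc b"
    and bal: "\<And>v. d \<le> v \<Longrightarrow> v \<le> N \<Longrightarrow> (k + 1) * card (R \<inter> {v<..}) \<le> N - v"
    by (auto simp: ballot_sets_def)
  have fin: "finite R" using sub finite_subset by blast
  show "R \<in> ?A \<union> ?B"
  proof (cases "Suc d \<in> R")
    case True
    have "R - {Suc d} \<subseteq> {Suc d<..N}"
    proof
      fix x assume "x \<in> R - {Suc d}"
      then have "d < x" "x \<le> N" "x \<noteq> Suc d" using sub by auto
      then show "x \<in> {Suc d<..N}" by simp
    qed
    moreover have "card (R - {Suc d}) = b" using True card fin by simp
    moreover have "(R - {Suc d}) \<inter> {v<..} = R \<inter> {v<..}" if "Suc d \<le> v" for v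
      using that by auto
    ultimately have "R - {Suc d} \<in> ballot_sets k N (Suc d) b"
      using bal by (simp add: ballot_sets_def)
    then show ?thesis using True by (metis UnI2 imageI insert_Diff)
  next
    case False
    then have "R \<subseteq> {Suc d<..N}"
      using sub by (auto simp: subset_iff) (metis Suc_lessI)
    then show ?thesis using card bal by (simp add: ballot_sets_def)
  qed
next
  fix R assume "R \<in> ?A \<union> ?B"
  then show "R \<in> ?L"
  proof
    assume R: "R \<in> ?A"
    then have sub: "R \<subseteq> {Suc d<..N}" and card: "card R = Suc b"
      and bal: "\<And>v. Suc d \<le> v \<Longrightarrow> v \<le> N \<Longrightarrow> (k + 1) * card (R \<inter> {v<..}) \<le> N - v"
      by (auto simp: ballot_sets_def)
    have "R \<inter> {d<..} = R" using sub by auto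
    then have "(k + 1) * card (R \<inter> {v<..}) \<le> N - v" if "d \<le> v" "v \<le> N" for v
      using that assms(2) bal[of v] card by (cases "v = d") auto
    moreover have "R \<subseteq> {d<..N}" using sub by auto
    ultimately show ?thesis using card by (simp add: ballot_sets_def)
  next
    assume "R \<in> ?B"
    then obtain S where S: "S \<in> ballot_sets k N (Suc d) b" and RS: "R = insert (Suc d) S"
      by blast
    have sub: "S \<subseteq> {Suc d<..N}" and cardS: "card S = b"
      and bal: "\<And>v. Suc d \<le> v \<Longrightarrow> v \<le> N \<Longrightarrow> (k + 1) * card (S \<inter> {v<..}) \<le> N - v"
      using S by (auto simp: ballot_sets_def)
    have "finite S" "Suc d \<notin> S" using sub finite_subset by auto
    then have card: "card R = Suc b" using cardS RS by simp
    have "R \<inter> {d<..} = R" using sub RS by auto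
    moreover have "R \<inter> {v<..} = S \<inter> {v<..}" if "Suc d \<le> v" for v
      using that RS by auto
    ultimately have "(k + 1) * card (R \<inter> {v<..}) \<le> N - v" if "d \<le> v" "v \<le> N" for v
      using that assms(2) bal[of v] card by (cases "v = d") auto
    moreover have "R \<subseteq> {d<..N}" using sub RS assms(1) by auto
    ultimately show ?thesis using card by (simp add: ballot_sets_def)
  qed
qed

lemma card_ballot_sets_Suc:
  assumes "d < N" "(k + 1) * Suc b \<le> N - d"
  shows "card (ballot_sets k N d (Suc b)) =
           card (ballot_sets k N (Suc d) (Suc b)) + card (ballot_sets k N (Suc d) b)"
proof -
  have notin: "Suc d \<notin> R" if "R \<in> ballot_sets k N (Suc d) c" for R c
    using that by (auto simp: ballot_sets_def)
  then have "inj_on (insert (Suc d)) (ballot_sets k N (Suc d) b)"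
    by (intro inj_onI) (metis insert_ident)
  moreover have "ballot_sets k N (Suc d) (Suc b) \<inter>
      insert (Suc d) ` ballot_sets k N (Suc d) b = {}"
    using notin by blast
  ultimately show ?thesis
    by (simp add: ballot_sets_Suc[OF assms] card_Un_disjoint finite_ballot_sets card_image)
qed

text \<open>Here \<open>X\<close> and \<open>Y\<close> stand for the counts after removing one leaf
  or one root from \<open>Suc a\<close> leaves and \<open>Suc b\<close> roots. The closed form is
  kept with its denominator multiplied out.\<close>

lemma ballot_number_recurrence:
  fixes k X Y :: real and a b :: nat
  assumes "real (Suc a) * X = (real (Suc a) - k * real (Suc b)) * real ((a + Suc b) choose Suc b)"
    and "(real (Suc a) + 1) * Y = (real (Suc a) + 1 - k * real b) * real ((Suc a + b) choose b)"
  shows "(real (Suc a) + 1) * (X + Y) =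
    (real (Suc a) + 1 - k * real (Suc b)) * real ((Suc a + Suc b) choose Suc b)"
proof -
  define A B Z where "A = real (Suc a)" and "B = real (Suc b)"
    and "Z = real ((Suc a + Suc b) choose Suc b)"
  have pos: "A > 0" "B > 0" "A + B > 0" "A + 1 > 0" by (auto simp: A_def B_def)
  \<comment> \<open>The absorption identities turn both smaller binomials into multiples of
    \<open>Z\<close>, after which only a polynomial identity in \<open>A\<close>, \<open>B\<close>
    and \<open>k\<close> remains.\<close>
  have "Suc b * ((Suc a + Suc b) choose Suc b) = (Suc a + Suc b) * ((Suc a + b) choose b)"
    using binomial_absorption[of b "Suc a + Suc b"] by simp
  then have "B * Z = (A + B) * real ((Suc a + b) choose b)"
    unfolding A_def B_def Z_def by (metis of_nat_add of_nat_mult)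
  then have Q: "real ((Suc a + b) choose b) = B * Z / (A + B)"
    using pos by (simp add: field_simps)
  have "Suc a * ((Suc a + Suc b) choose Suc b) = (Suc a + Suc b) * ((a + Suc b) choose Suc b)"
    using binomial_absorb_comp[of "Suc a + Suc b" "Suc b"] by simp
  then have "A * Z = (A + B) * real ((a + Suc b) choose Suc b)"
    unfolding A_def B_def Z_def by (metis of_nat_add of_nat_mult)
  then have P: "real ((a + Suc b) choose Suc b) = A * Z / (A + B)"
    using pos by (simp add: field_simps)
  have "A * X = (A - k * B) * (A * Z / (A + B))"
    using assms(1) unfolding P by (simp add: A_def B_def)
  then have "A * X = A * ((A - k * B) * Z / (A + B))" by simp
  then have X: "X = (A - k * B) * Z / (A + B)" using pos by (subst (asm) mult_cancel_left) simp
  have "(A + 1) * Y = (A + 1 - k * (B - 1)) * (B * Z / (A + B))"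
    using assms(2) unfolding Q by (simp add: A_def B_def)
  then have "(A + 1) * (X + Y) =
      ((A + 1) * (A - k * B) + (A + 1 - k * (B - 1)) * B) * Z / (A + B)"
    using X by (simp add: distrib_left add_divide_distrib distrib_right)
  also have "(A + 1) * (A - k * B) + (A + 1 - k * (B - 1)) * B = (A + 1 - k * B) * (A + B)"
    by (simp add: algebra_simps)
  finally show ?thesis using pos by (simp add: A_def B_def Z_def)
qed

text \<open>The generalized ballot number for \<open>a\<close> leaves and \<open>b\<close> roots, by
  induction on the number of labels. The bound is \<open>a + 1\<close> instead of \<open>a\<close>
  because removing a leaf from a sequence with \<open>k * b = a\<close> leads just outside the
  ballot region, where the formula still holds.\<close>

lemma card_ballot_sets:
  assumes "k \<ge> 1" "N = d + (a + b)" "k * b \<le> a + 1"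
  shows "(real a + 1) * real (card (ballot_sets k N d b)) =
           (real a + 1 - real k * real b) * real ((a + b) choose b)"
  using assms(2,3)
proof (induction "a + b" arbitrary: d a b)
  case 0
  then show ?case by (simp add: ballot_sets_0)
next
  case (Suc m)
  show ?case
  proof (cases b)
    case 0
    then show ?thesis by (simp add: ballot_sets_0)
  next
    case b: (Suc c)
    show ?thesis
    \<comment> \<open>Just outside the region both sides vanish: no set is ballot, and the factor
      \<open>a + 1 - k * b\<close> is zero.\<close>
    proof (cases "k * b = a + 1")
      case True
      then have "real k * real b = real a + 1" by (metis of_nat_1 of_nat_add of_nat_mult)
      then show ?thesis using Suc.prems True by (subst ballot_sets_empty) auto
    next
      case False
      then have le: "k * b \<le> a" using Suc.prems by simp
      then have "a > 0" using assms(1) b by (cases "a = 0") auto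
      then obtain a' where a: "a = Suc a'" using gr0_implies_Suc by blast
      have "card (ballot_sets k N d b) =
          card (ballot_sets k N (Suc d) b) + card (ballot_sets k N (Suc d) c)"
        unfolding b by (rule card_ballot_sets_Suc) (use Suc.prems le b in auto)
      moreover have "(real a' + 1) * real (card (ballot_sets k N (Suc d) b)) =
          (real a' + 1 - real k * real b) * real ((a' + b) choose b)"
        by (rule Suc.hyps(1)) (use Suc.hyps(2) Suc.prems le a in auto)
      moreover have "(real a + 1) * real (card (ballot_sets k N (Suc d) c)) =
          (real a + 1 - real k * real c) * real ((a + c) choose c)"
        by (rule Suc.hyps(1)) (use Suc.hyps(2) Suc.prems le b in auto)
      ultimately show ?thesis
        using ballot_number_recurrence[of a' "real (card (ballot_sets k N (Suc d) b))" "real k" c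
            "real (card (ballot_sets k N (Suc d) c))"]
        unfolding a b by (simp add: add.commute)
    qed
  qed
qed

section \<open>Subsequences and the word of a forest\<close>

lemma contains_pattern_123:
  "contains_pattern w [1, 2, 3] \<longleftrightarrow> (\<exists>a b c. subseq [a, b, c] w \<and> a < b \<and> b < c)"
proof
  assume "contains_pattern w [1, 2, 3]"
  then obtain u where u: "subseq u w" "order_isomorphic u [1, 2, 3]"
    by (auto simp: contains_pattern_def)
  then have "length u = 3" by (simp add: order_isomorphic_def)
  then obtain a b c where abc: "u = [a, b, c]"
    by (auto simp: numeral_3_eq_3 length_Suc_conv)
  have iso: "u ! i < u ! j \<longleftrightarrow> [1, 2, 3::nat] ! i < [1, 2, 3] ! j" if "i < 3" "j < 3" for i j
    using u(2) that abc by (simp add: order_isomorphic_def)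
  have "a < b" "b < c" using iso[of 0 1] iso[of 1 2] abc by simp_all
  then show "\<exists>a b c. subseq [a, b, c] w \<and> a < b \<and> b < c" using u abc by blast
next
  assume "\<exists>a b c. subseq [a, b, c] w \<and> a < b \<and> b < c"
  then obtain a b c where "subseq [a, b, c] w" "a < b" "b < c" by blast
  moreover from this have "order_isomorphic [a, b, c] [1, 2, 3]"
    by (simp add: order_isomorphic_def All_less_Suc)
  ultimately show "contains_pattern w [1, 2, 3]" by (auto simp: contains_pattern_def)
qed

text \<open>In this form sortedness passes to subsequences by transitivity of
  \<open>subseq\<close>.\<close>

lemma sorted_wrt_iff_subseq: "sorted_wrt P xs \<longleftrightarrow> (\<forall>x y. subseq [x, y] xs \<longrightarrow> P x y)"
proof (induction xs)
  case (Cons z zs)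
  have "subseq [x, y] (z # zs) \<longleftrightarrow> x = z \<and> y \<in> set zs \<or> subseq [x, y] zs" for x y
    by (auto simp: subseq_singleton_left dest: subseq_Cons')
  then show ?case using Cons by auto
qed simp

lemma forest_perm_Nil [simp]: "forest_perm [] = []"
  and forest_perm_Cons [simp]: "forest_perm (s # F) = root s # leaves s @ forest_perm F"
  by (simp_all add: forest_perm_def shrub_word_def)

lemma set_forest_perm:
  "set (forest_perm F) = set (map root F) \<union> set (concat (map leaves F))"
  by (induction F) auto

lemma distinct_forest_perm:
  "distinct (forest_perm F) \<longleftrightarrow> distinct (map root F) \<and> distinct (concat (map leaves F)) \<and>
     set (map root F) \<inter> set (concat (map leaves F)) = {}"
  by (induction F) (auto simp: set_forest_perm)

lemma subseq_shrub_forest_perm: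
  "s \<in> set F \<Longrightarrow> subseq (root s # leaves s) (forest_perm F)"
proof (induction F)
  case (Cons t F)
  show ?case
  proof (cases "s = t")
    case False
    then have "subseq (root s # leaves s) (forest_perm F)" using Cons by simp
    then have "subseq (root s # leaves s) ((root t # leaves t) @ forest_perm F)"
      by (rule list_emb_append2)
    then show ?thesis by (simp only: forest_perm_Cons append_Cons)
  qed (simp add: list_emb_prefix)
qed simp

section \<open>Avoiding 123 means decreasing roots and decreasing leaves\<close>

text \<open>Induction on the shrubs: only comparisons involving the first shrub are new, and each
  ascent among them would extend to a 123. Nonempty leaf lists supply the third entry after two
  ascending roots.\<close>

lemma avoiding_imp_decreasing:
  assumes "\<not> contains_pattern (forest_perm F) [1, 2, 3]" "distinct (forest_perm F)"
    "\<forall>s\<in>set F. leaves s \<noteq> [] \<and> (\<forall>l\<in>set (leaves s). root s < l)"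
  shows "sorted_wrt (>) (map root F) \<and> sorted_wrt (>) (concat (map leaves F))"
  using assms
proof (induction F)
  case (Cons s F)
  have no: "\<not> (x < y \<and> y < z)" if "subseq [x, y, z] (forest_perm (s # F))" for x y z
    using Cons.prems(1) that contains_pattern_123 by blast
  have "\<not> contains_pattern (forest_perm F) [1, 2, 3]"
    using no unfolding contains_pattern_123
    by (metis forest_perm_Cons list_emb_append2 list_emb_Cons)
  then have IH: "sorted_wrt (>) (map root F)" "sorted_wrt (>) (concat (map leaves F))"
    using Cons by auto
  have "root t < root s" if t: "t \<in> set F" for t
  proof -
    obtain l where l: "l \<in> set (leaves t)" "root t < l"
      using Cons.prems(3) t by (metis list.set_intros(2) neq_Nil_conv list.set_intros(1))
    have "subseq [root t, l] (root t # leaves t)" using l by (simp add: subseq_singleton_left)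
    then have "subseq [root t, l] (forest_perm F)"
      using subseq_shrub_forest_perm[OF t] subseq_order.trans by blast
    then have "subseq [root s, root t, l] (forest_perm (s # F))"
      by (auto intro: list_emb_append2)
    then have "\<not> root s < root t" using no l by blast
    moreover have "root s \<noteq> root t" using Cons.prems(2) t by (auto simp: set_forest_perm)
    ultimately show ?thesis by simp
  qed
  \<comment> \<open>The root of \<open>s\<close> precedes \<open>x\<close> and is smaller, so
    \<open>x < y\<close> would give the 123 \<open>root s\<close>, \<open>x\<close>,
    \<open>y\<close>. Here \<open>y\<close> may be a leaf of \<open>s\<close> or of any later
    shrub.\<close>
  moreover have desc: "y < x" if xy: "subseq [x, y] (leaves s @ concat (map leaves F))"
    and x: "x \<in> set (leaves s)" for x y
  proof -
    have "subseq (concat (map leaves F)) (forest_perm F)"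
      by (induction F) (auto intro: list_emb_append_mono)
    then have "subseq (leaves s @ concat (map leaves F)) (leaves s @ forest_perm F)"
      by (intro list_emb_append_mono) auto
    then have sub: "subseq [x, y] (leaves s @ forest_perm F)"
      using xy subseq_order.trans by blast
    then have "\<not> x < y" using no[of "root s" x y] Cons.prems(3) x by auto
    moreover have "distinct zs \<Longrightarrow> subseq [x, y] zs \<Longrightarrow> x \<noteq> y" for zs
      by (induction zs) (auto simp: subseq_singleton_left split: if_splits)
    then have "x \<noteq> y" using sub Cons.prems(2)
      by (metis distinct_append forest_perm_Cons distinct.simps(2))
    ultimately show ?thesis by simp
  qed
  moreover have "sorted_wrt (>) (leaves s)"
    unfolding sorted_wrt_iff_subseq
  proof (intro allI impI)
    fix x y assume sub: "subseq [x, y] (leaves s)"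
    then have "x \<in> set (leaves s)"
      by (rule list_emb_set) auto
    moreover have "subseq [x, y] (leaves s @ concat (map leaves F))"
      using list_emb_append_mono[OF sub list_emb_Nil] by simp
    ultimately show "y < x" by (intro desc)
  qed
  moreover have "\<forall>x\<in>set (leaves s). \<forall>y\<in>set (concat (map leaves F)). y < x"
    using desc by (metis append_Cons append_Nil list_emb_append_mono subseq_singleton_left)
  ultimately show ?case using IH by (auto simp: sorted_wrt_append)
qed simp

text \<open>The word is a shuffle of two decreasing sequences. Filtering by membership in the root
  set recovers each of them, and filtering an occurrence of 123 gives subsequences of them.\<close>

lemma decreasing_imp_avoiding:
  assumes "distinct (forest_perm F)"
    "sorted_wrt (>) (map root F)" "sorted_wrt (>) (concat (map leaves F))"
  shows "\<not> contains_pattern (forest_perm F) [1, 2, 3]"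
proof
  assume "contains_pattern (forest_perm F) [1, 2, 3]"
  then obtain a b c where abc: "subseq [a, b, c] (forest_perm F)" "a < b" "b < c"
    using contains_pattern_123 by blast
  let ?R = "\<lambda>x. x \<in> set (map root F)"
  have roots: "filter ?R (forest_perm F) = map root F"
    and leaves: "filter (\<lambda>x. \<not> ?R x) (forest_perm F) = concat (map leaves F)"
  proof -
    \<comment> \<open>The predicate is arbitrary so that it stays fixed in the induction, whereas
      the set of roots would shrink with the list.\<close>
    have "filter P (forest_perm G) = map root G"
      if "\<forall>x\<in>set (map root G). P x" "\<forall>x\<in>set (concat (map leaves G)). \<not> P x" for P G
      using that by (induction G) auto
    moreover have "filter P (forest_perm G) = concat (map leaves G)"
      if "\<forall>x\<in>set (map root G). \<not> P x" "\<forall>x\<in>set (concat (map leaves G)). P x" for P G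
      using that by (induction G) auto
    moreover have "\<forall>x\<in>set (map root F). ?R x" "\<forall>x\<in>set (concat (map leaves F)). \<not> ?R x"
      using assms(1) unfolding distinct_forest_perm by blast+
    ultimately show "filter ?R (forest_perm F) = map root F"
      "filter (\<lambda>x. \<not> ?R x) (forest_perm F) = concat (map leaves F)"
      by simp_all
  qed
  have "sorted_wrt (>) (filter ?R [a, b, c])"
    using subseq_filter[OF abc(1), of ?R] assms(2) subseq_order.trans
    unfolding roots sorted_wrt_iff_subseq by blast
  moreover have "sorted_wrt (>) (filter (\<lambda>x. \<not> ?R x) [a, b, c])"
    using subseq_filter[OF abc(1), of "\<lambda>x. \<not> ?R x"] assms(3) subseq_order.trans
    unfolding leaves sorted_wrt_iff_subseq by blast
  \<comment> \<open>Two of the three entries are both roots or both leaves.\<close>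
  ultimately show False using abc(2,3) by (auto split: if_splits)
qed

section \<open>The ballot condition for root sets\<close>

lemma length_forest_perm:
  "\<forall>s\<in>set F. length (leaves s) = k \<Longrightarrow> length (forest_perm F) = (k + 1) * length F"
  by (induction F) auto

lemma length_concat_leaves:
  "\<forall>s\<in>set F. length (leaves s) = k \<Longrightarrow> length (concat (map leaves F)) = k * length F"
  by (induction F) auto

text \<open>A shrub whose root exceeds \<open>v\<close> has all its \<open>k + 1\<close> labels
  above \<open>v\<close>. The labels of all such shrubs, collected in \<open>G\<close>, are distinct
  and must fit into \<open>{v<..(k + 1) * n}\<close>.\<close>

lemma roots_in_ballot_sets:
  assumes "shrub_forest k n F"
  shows "set (map root F) \<in> ballot_sets k ((k + 1) * n) 0 n"
proof -
  let ?N = "(k + 1) * n"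
  have F: "length F = n" "\<forall>s\<in>set F. length (leaves s) = k"
    "\<forall>s\<in>set F. \<forall>l\<in>set (leaves s). root s < l"
    "distinct (forest_perm F)" "set (forest_perm F) = {1..?N}"
    using assms by (auto simp: shrub_forest_def)
  have dist: "distinct (map root F)" using F(4) distinct_forest_perm by blast
  have "(k + 1) * card (set (map root F) \<inter> {v<..}) \<le> ?N - v" for v
  proof -
    define G where "G = filter (\<lambda>s. v < root s) F"
    have roots: "map root G = filter (\<lambda>x. v < x) (map root F)"
      by (simp add: G_def filter_map comp_def)
    have "card (set (map root F) \<inter> {v<..}) = card (set (map root G))"
      unfolding roots by (rule arg_cong[of _ _ card]) auto
    also have "\<dots> = length G"
      using dist roots by (metis distinct_card distinct_filter length_map)
    finally have "(k + 1) * card (set (map root F) \<inter> {v<..}) = length (forest_perm G)"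
      using F(2) length_forest_perm[of G k] by (simp add: G_def)
    also have "\<dots> = card (set (forest_perm G))"
    proof -
      have "distinct (forest_perm G)" using F(4) unfolding G_def
        by (induction F) (auto simp: set_forest_perm)
      then show ?thesis by (simp add: distinct_card)
    qed
    also have "\<dots> \<le> card {v<..?N}"
    proof (rule card_mono)
      have "set (forest_perm G) \<subseteq> {1..?N}"
        unfolding F(5)[symmetric] by (auto simp: set_forest_perm G_def)
      moreover have "\<forall>x\<in>set (forest_perm G). v < x"
        using F(3) by (force simp: set_forest_perm G_def)
      ultimately show "set (forest_perm G) \<subseteq> {v<..?N}" by auto
    qed simp
    finally show ?thesis by simp
  qed
  moreover have "set (map root F) \<subseteq> {0<..?N}"
  proof -
    have "set (map root F) \<subseteq> {1..?N}" using F(5) unfolding set_forest_perm by blast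
    also have "\<dots> = {0<..?N}" by auto
    finally show ?thesis .
  qed
  moreover have "card (set (map root F)) = n" using dist F(1) by (metis distinct_card length_map)
  ultimately show ?thesis by (simp add: ballot_sets_def)
qed

section \<open>Uniqueness of the forest with a given root set\<close>

lemma decreasing_lists_eqI:
  fixes xs ys :: "nat list"
  assumes "sorted_wrt (>) xs" "sorted_wrt (>) ys" "set xs = set ys"
  shows "xs = ys"
proof -
  have "rev xs = rev ys"
    using assms by (intro strict_sorted_equal) (auto simp: sorted_wrt_rev)
  then show ?thesis by simp
qed

text \<open>Since every block has length \<open>k\<close>, the concatenated leaf list can be cut
  into shrubs in only one way.\<close>

lemma forest_eqI:
  assumes "\<forall>s\<in>set F. length (leaves s) = k" "\<forall>s\<in>set G. length (leaves s) = k"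
    "map root F = map root G" "concat (map leaves F) = concat (map leaves G)"
  shows "F = G"
  using assms
proof (induction F arbitrary: G)
  case (Cons s F)
  obtain t G' where G: "G = t # G'" using Cons.prems(3) by (cases G) simp_all
  have len: "length (leaves s) = length (leaves t)" using Cons.prems(1,2) unfolding G by simp
  have roots: "root s = root t" "map root F = map root G'" using Cons.prems(3) unfolding G by auto
  have cat: "leaves s = leaves t" "concat (map leaves F) = concat (map leaves G')"
    using Cons.prems(4) append_eq_append_conv[OF disjI1[OF len]] unfolding G
    by (simp_all only: list.map concat.simps)
  have "F = G'"
    by (rule Cons.IH[OF _ _ roots(2) cat(2)]) (use Cons.prems(1,2) in \<open>simp_all add: G\<close>)
  then show ?case using roots(1) cat(1) unfolding G by (simp add: shrub.expand)
qed simp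

lemma avoiding_forestsD:
  assumes "F \<in> avoiding_forests k n {[1, 2, 3]}" "k \<ge> 1"
  shows "shrub_forest k n F"
    "sorted_wrt (>) (map root F)" "sorted_wrt (>) (concat (map leaves F))"
    "set (concat (map leaves F)) = {1..(k + 1) * n} - set (map root F)"
proof -
  show F: "shrub_forest k n F" using assms by (simp add: avoiding_forests_def)
  have "\<forall>s\<in>set F. leaves s \<noteq> [] \<and> (\<forall>l\<in>set (leaves s). root s < l)"
    using F assms(2) by (auto simp: shrub_forest_def)
  then show "sorted_wrt (>) (map root F)" "sorted_wrt (>) (concat (map leaves F))"
    using avoiding_imp_decreasing[of F] assms F
    by (auto simp: avoiding_forests_def shrub_forest_def)
  show "set (concat (map leaves F)) = {1..(k + 1) * n} - set (map root F)"
    using F unfolding shrub_forest_def distinct_forest_perm set_forest_perm by blast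
qed

text \<open>The root set fixes the leaf set as its complement, and a decreasing list is fixed by its
  set.\<close>

lemma inj_on_root_set:
  assumes "k \<ge> 1"
  shows "inj_on (\<lambda>F. set (map root F)) (avoiding_forests k n {[1, 2, 3]})"
proof (rule inj_onI)
  fix F G assume FG: "F \<in> avoiding_forests k n {[1, 2, 3]}" "G \<in> avoiding_forests k n {[1, 2, 3]}"
    and eq: "set (map root F) = set (map root G)"
  note F = avoiding_forestsD[OF FG(1) assms] and G = avoiding_forestsD[OF FG(2) assms]
  show "F = G"
  proof (rule forest_eqI)
    show "map root F = map root G" by (rule decreasing_lists_eqI[OF F(2) G(2) eq])
    show "concat (map leaves F) = concat (map leaves G)"
      by (rule decreasing_lists_eqI[OF F(3) G(3)]) (simp only: F(4) G(4) eq)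
  qed (use F(1) G(1) in \<open>auto simp: shrub_forest_def\<close>)
qed

section \<open>Reconstruction of a forest from a ballot set\<close>

lemma ex_forest:
  assumes "length ls = k * length rs"
  shows "\<exists>F. map root F = rs \<and> concat (map leaves F) = ls \<and> (\<forall>s\<in>set F. length (leaves s) = k)"
  using assms
proof (induction rs arbitrary: ls)
  case (Cons r rs)
  then obtain F where "map root F = rs" "concat (map leaves F) = drop k ls"
    "\<forall>s\<in>set F. length (leaves s) = k"
    by (metis add_diff_cancel_left' length_Cons length_drop mult_Suc_right)
  then show ?case using Cons.prems by (intro exI[of _ "Shrub r (take k ls) # F"]) auto
qed simp

text \<open>Suppose a leaf \<open>l\<close> lies below its root, with \<open>i\<close> shrubs to the
  left. Then \<open>i + 1\<close> roots exceed \<open>l\<close>, so the ballot condition demands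
  \<open>k * (i + 1)\<close> leaves above \<open>l\<close>. Only leaves to the left of
  \<open>l\<close> can be larger, and there are at most \<open>k * i + (k - 1)\<close> of
  them.\<close>

lemma decreasing_forest_root_less:
  assumes dec: "sorted_wrt (>) (map root F)" "sorted_wrt (>) (concat (map leaves F))"
    and len: "\<forall>s\<in>set F. length (leaves s) = k"
    and disj: "set (map root F) \<inter> set (concat (map leaves F)) = {}"
    and ballot: "\<And>v. v \<in> set (concat (map leaves F)) \<Longrightarrow>
      k * card (set (map root F) \<inter> {v<..}) \<le> card (set (concat (map leaves F)) \<inter> {v<..})"
    and s: "s \<in> set F" and l: "l \<in> set (leaves s)"
  shows "root s < l"
proof (rule ccontr)
  assume "\<not> root s < l"
  moreover have "root s \<noteq> l" using disj s l by auto
  ultimately have less: "l < root s" by simp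
  obtain xs ys where F: "F = xs @ s # ys" using s split_list by metis
  have dist: "distinct (map root F)"
    using dec(1) by (metis sorted_wrt_rev strict_sorted_iff distinct_rev)
  have k: "length (leaves s) = k" "k > 0" using len s l by auto
  have "set (map root (xs @ [s])) \<subseteq> set (map root F) \<inter> {l<..}"
    using dec(1) less unfolding F by (fastforce simp: sorted_wrt_append)
  then have "card (set (map root (xs @ [s]))) \<le> card (set (map root F) \<inter> {l<..})"
    by (intro card_mono) auto
  moreover have "card (set (map root (xs @ [s]))) = Suc (length xs)"
    using dist unfolding F by (subst distinct_card) auto
  ultimately have "Suc (length xs) \<le> card (set (map root F) \<inter> {l<..})" by simp
  then have "k * Suc (length xs) \<le> k * card (set (map root F) \<inter> {l<..})" by (rule mult_le_mono2)
  also have "\<dots> \<le> card (set (concat (map leaves F)) \<inter> {l<..})"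
    using s l by (intro ballot) auto
  \<comment> \<open>As the leaves decrease, those above \<open>l\<close> lie in earlier shrubs or in
    \<open>s\<close> itself; excluding \<open>l\<close> gains the one unit needed for the
    contradiction.\<close>
  also have "\<dots> \<le> card (set (concat (map leaves xs)) \<union> (set (leaves s) - {l}))"
    using dec(2) l unfolding F by (intro card_mono) (auto simp: sorted_wrt_append dest: order.asym)
  also have "\<dots> \<le> card (set (concat (map leaves xs))) + card (set (leaves s) - {l})"
    by (rule card_Un_le)
  also have "\<dots> \<le> k * length xs + (k - 1)"
  proof (rule add_mono)
    show "card (set (concat (map leaves xs))) \<le> k * length xs"
      using card_length length_concat_leaves[of xs k] len unfolding F
      by (metis Un_iff set_append)
    show "card (set (leaves s) - {l}) \<le> k - 1"
      using l card_length[of "leaves s"] k by (simp add: diff_le_mono)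
  qed
  finally show False using k by simp
qed

text \<open>The forest takes \<open>R\<close> in decreasing order as its roots and the complement in
  decreasing order as its leaves, cut into blocks of \<open>k\<close>.\<close>

lemma ballot_set_is_root_set:
  assumes R: "R \<in> ballot_sets k ((k + 1) * n) 0 n"
  shows "\<exists>F\<in>avoiding_forests k n {[1, 2, 3]}. set (map root F) = R"
proof -
  let ?N = "(k + 1) * n"
  have sub: "R \<subseteq> {1..?N}" and card: "card R = n"
    and bal: "\<And>v. v \<le> ?N \<Longrightarrow> (k + 1) * card (R \<inter> {v<..}) \<le> ?N - v"
    using R by (auto simp: ballot_sets_def)
  have fin: "finite R" using sub finite_subset by blast
  have cardL: "card ({1..?N} - R) = k * n"
    using sub card fin by (simp add: card_Diff_subset)
  define rs ls where "rs = rev (sorted_list_of_set R)"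
    and "ls = rev (sorted_list_of_set ({1..?N} - R))"
  have rs: "sorted_wrt (>) rs" "set rs = R" "length rs = n"
    and ls: "sorted_wrt (>) ls" "set ls = {1..?N} - R" "length ls = k * n"
    using fin card cardL by (auto simp: rs_def ls_def sorted_wrt_rev)
  obtain F where F: "map root F = rs" "concat (map leaves F) = ls"
    "\<forall>s\<in>set F. length (leaves s) = k"
    using ex_forest[of ls k rs] rs ls by auto
  have lenF: "length F = n" using F(1) rs(3) by (metis length_map)
  have "distinct rs" "distinct ls" by (simp_all add: rs_def ls_def)
  then have dist: "distinct (forest_perm F)"
    unfolding distinct_forest_perm F using rs ls by auto
  \<comment> \<open>Splitting the labels above \<open>v\<close> into roots and leaves and cancelling
    the roots once turns the factor \<open>k + 1\<close> into \<open>k\<close>.\<close>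
  have "k * card (R \<inter> {v<..}) \<le> card (({1..?N} - R) \<inter> {v<..})" if "v \<in> {1..?N} - R" for v
  proof -
    have "card {v<..?N} = card ((R \<inter> {v<..}) \<union> (({1..?N} - R) \<inter> {v<..}))"
      using sub by (intro arg_cong[of _ _ card]) auto
    also have "\<dots> = card (R \<inter> {v<..}) + card (({1..?N} - R) \<inter> {v<..})"
      using fin by (intro card_Un_disjoint) auto
    finally show ?thesis using bal[of v] that by simp
  qed
  then have "\<forall>s\<in>set F. \<forall>l\<in>set (leaves s). root s < l"
    using F rs ls by (intro ballI decreasing_forest_root_less[of F k]) auto
  moreover have "set (forest_perm F) = {1..?N}"
    unfolding set_forest_perm F rs ls using sub by auto
  ultimately have "shrub_forest k n F"
    using F(3) dist lenF by (auto simp: shrub_forest_def)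
  moreover have "\<not> contains_pattern (forest_perm F) [1, 2, 3]"
    using decreasing_imp_avoiding[OF dist] F rs ls by simp
  ultimately have "F \<in> avoiding_forests k n {[1, 2, 3]}" by (simp add: avoiding_forests_def)
  then show ?thesis using F(1) rs(2) by metis
qed

section \<open>The enumeration of 123-avoiding forests\<close>

theorem theorem3:
  fixes k n :: nat
  assumes "k \<ge> 2"
  shows "real (card (avoiding_forests k n {[1, 2, 3]})) =
           1 / (real k * real n + 1) * real (((k + 1) * n) choose n)"
proof -
  have k: "k \<ge> 1" using assms by simp
  let ?A = "avoiding_forests k n {[1, 2, 3]}" and ?B = "ballot_sets k ((k + 1) * n) 0 n"
  have "(\<lambda>F. set (map root F)) ` ?A = ?B"
  proof
    show "(\<lambda>F. set (map root F)) ` ?A \<subseteq> ?B"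
      using roots_in_ballot_sets avoiding_forestsD(1)[OF _ k] by blast
    show "?B \<subseteq> (\<lambda>F. set (map root F)) ` ?A"
      using ballot_set_is_root_set by blast
  qed
  then have "card ?A = card ?B"
    using card_image[OF inj_on_root_set[OF k, of n]] by simp
  \<comment> \<open>With \<open>k * n\<close> leaves and \<open>n\<close> roots the factor
    \<open>a + 1 - k * b\<close> of the ballot number equals 1.\<close>
  moreover have "(real (k * n) + 1) * real (card ?B) =
      (real (k * n) + 1 - real k * real n) * real ((k * n + n) choose n)"
    by (rule card_ballot_sets) (use k in auto)
  moreover have "real k * real n + 1 > 0" by (simp add: add_nonneg_pos)
  ultimately show ?thesis by (simp add: field_simps)
qed

end
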